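(* For all complex $x$ with $0<|x|\le 1/4$, put \[ z=z(x)=\frac{\sqrt{1+16x^2}-1}{4x}. \] Then \[ \sum_{n=0}^\infty (-1)^{n+1}\frac{4n+1}{4n+3}O_{2n}^{(2)}C_{2n}x^{2n} = \frac{\arctan\sqrt{z}+\operatorname{arctanh}\sqrt{z}}{24\sqrt{2x^3}}\Big(\arctan^2\sqrt{z} - 4\arctan\sqrt{z}\,\operatorname{arctanh}\sqrt{z} + \operatorname{arctanh}^2\sqrt{z}\Big) \] and \[ \sum_{n=0}^\infty (-1)^{n+1}\frac{4n+3}{4n+5}O_{2n+1}^{(2)}C_{2n+1}x^{2n} = \frac{\arctan\sqrt{z}-\operatorname{arctanh}\sqrt{z}}{24\sqrt{2x^5}}\Big(\arctan^2\sqrt{z} + 4\arctan\sqrt{z}\,\operatorname{arctanh}\sqrt{z} + \operatorname{arctanh}^2\sqrt{z}\Big). \]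
   Context: $C_k=\frac{1}{k+1}\binom{2k}{k}$ are the Catalan numbers and $O_k^{(2)}=\sum_{j=0}^k\frac{1}{(2j+1)^2}$ ($k\ge0$) are the second order odd harmonic numbers. Square roots, $\arctan$ and $\operatorname{arctanh}$ of complex arguments denote principal branches.
   Formalization: The roots √(2x³) and √(2x⁵) are taken as √2·(√x)³ and √2·(√x)⁵ with principal √x; with principal roots of 2x³ and 2x⁵ themselves the identities have the wrong sign on part of the disc (e.g. the first for small x<0). *)

theory Defs
  imports "HOL-Analysis.Analysis"
begin

definition catalan :: "nat \<Rightarrow> real" where
  "catalan k = 1 / (real k + 1) * real ((2 * k) choose k)"

definition odd_harm2 :: "nat \<Rightarrow> real" where
  "odd_harm2 k = (\<Sum>j=0..k. 1 / (2 * real j + 1)\<^sup>2)"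

(* The root of 2 x^k (k odd) is to be read as (csqrt 2) (csqrt x)^k, i.e. as sqrt 2 times the
   principal power x^(k/2).  It always is a square root of 2 x^k, and it is the principal one
   as long as taking the k-th power does not leave the principal sector.  Outside of that sector
   the principal root of 2 x^k differs by a sign on part of the disc, which an even power
   series in x cannot follow: for k = 3 this already happens on the negative real axis. *)
lemma half_power_square: "(csqrt 2 * csqrt x ^ k)\<^sup>2 = 2 * x ^ k"
proof -
  have "(csqrt 2 * csqrt x ^ k)\<^sup>2 = (csqrt 2)\<^sup>2 * ((csqrt x)\<^sup>2) ^ k"
    by (simp only: power_mult_distrib power_mult[symmetric] mult.commute)
  then show ?thesis
    by (simp only: power2_csqrt)
qed

lemma half_power_principal:
  assumes "x \<noteq> 0" "- pi < real k * Arg x" "real k * Arg x \<le> pi"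
  shows "csqrt (2 * x ^ k) = csqrt 2 * csqrt x ^ k"
proof -
  let ?w = "Ln 2 + of_nat k * Ln x"
  have Im: "Im ?w = real k * Arg x"
    using assms(1) Ln_of_real[of 2] by (simp add: Arg_eq_Im_Ln)
  have "exp ?w = 2 * x ^ k"
    using assms(1) by (simp add: exp_add exp_of_nat_mult)
  then have "Ln (2 * x ^ k) = ?w"
    using Ln_exp[of ?w] assms Im by simp
  then have "csqrt (2 * x ^ k) = exp (Ln 2 / 2) * exp (of_nat k * (Ln x / 2))"
    using assms(1) by (simp add: csqrt_exp_Ln add_divide_distrib exp_add)
  also have "\<dots> = csqrt 2 * csqrt x ^ k"
    using assms(1) csqrt_exp_Ln[of 2] csqrt_exp_Ln[of x] by (simp only: exp_of_nat_mult) simp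
  finally show ?thesis .
qed

lemma half_power_negative_real:
  assumes "r > 0"
  shows "csqrt (2 * (- complex_of_real r) ^ 3) = - (csqrt 2 * csqrt (- complex_of_real r) ^ 3)"
proof -
  have i_cubed: "\<i> ^ 3 = - \<i>"
    by (simp add: power3_eq_cube)
  have "csqrt (2 * (- complex_of_real r) ^ 3) = csqrt (complex_of_real (- (2 * r ^ 3)))"
    by simp
  also have "\<dots> = \<i> * complex_of_real (sqrt (2 * r ^ 3))"
    using assms by (subst csqrt_of_real_nonpos) auto
  also have "sqrt (2 * r ^ 3) = sqrt 2 * sqrt r ^ 3"
    by (simp add: real_sqrt_mult real_sqrt_power)
  also have "\<i> * complex_of_real (sqrt 2 * sqrt r ^ 3)
             = - (csqrt 2 * (\<i> * complex_of_real (sqrt r)) ^ 3)"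
    by (simp only: power_mult_distrib of_real_mult of_real_power i_cubed)
      (simp add: mult_ac)
  also have "\<i> * complex_of_real (sqrt r) = csqrt (complex_of_real (- r))"
    using assms by (subst csqrt_of_real_nonpos) auto
  finally show ?thesis
    by simp
qed

end

theory Submission
  imports Defs
begin

text \<open>With \<open>a\<^sub>k = (2k + 1) / (2k + 3) O\<^sub>k C\<^sub>k\<close>, the numbers \<open>a\<^sub>k\<close> are, up to powers of two, the Taylor
  coefficients of \<open>Arcsin\<^sup>3\<close>: for \<open>0 < |t| \<le> 1\<close> the series of \<open>a\<^sub>k (t\<^sup>2 / 4)\<^sup>k\<close> is
  \<open>Arcsin\<^sup>3 t / (3 t\<^sup>3)\<close>.  The two sums of the theorem are the even and the odd part of this series
  at \<open>t\<^sup>2 / 4 = \<plusminus>\<i> x\<close>, that is at \<open>t = (1 \<plusminus> \<i>) \<surd>2 \<surd>x\<close>.  With \<open>A = arctan \<surd>z\<close> and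
  \<open>B = artanh \<surd>z\<close>, the relation \<open>z / (1 - z\<^sup>2) = 2 x\<close> and the addition theorem give
  \<open>sin (A \<plusminus> \<i> B) = t\<close>, and \<open>|z| \<le> 1\<close> keeps \<open>A \<plusminus> \<i> B\<close> in the principal strip.  What remains is
  \<open>(1 + \<i>) (A + \<i> B)\<^sup>3 = (A + B) (A\<^sup>2 - 4 A B + B\<^sup>2) + \<i> (A - B) (A\<^sup>2 + 4 A B + B\<^sup>2)\<close> and its formal
  conjugate.\<close>

subsection \<open>The Taylor series of the cubed arcsine\<close>

lemma Arcsin_domain: "norm (t::complex) < 1 \<Longrightarrow> Im t = 0 \<Longrightarrow> \<bar>Re t\<bar> < 1"
  using abs_Re_le_cmod[of t] by linarith

lemma cos_Arcsin_nonzero: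
  assumes "norm t < 1"
  shows "cos (Arcsin t) \<noteq> 0"
proof
  assume "cos (Arcsin t) = 0"
  then have "t\<^sup>2 = 1"
    using sin_cos_squared_add[of "Arcsin t"] by simp
  then show False
    using assms by (auto simp: power2_eq_1_iff)
qed

lemma cos_Arcsin_squared: "(cos (Arcsin t))\<^sup>2 = 1 - t\<^sup>2"
  using sin_cos_squared_add[of "Arcsin t"] by (simp add: algebra_simps)

lemma zero_derivative_ball:
  fixes f :: "complex \<Rightarrow> complex"
  assumes "\<And>t. norm t < 1 \<Longrightarrow> (f has_field_derivative 0) (at t)" and "norm t < 1"
  shows "f t = f 0"
proof -
  have "\<exists>c. \<forall>x\<in>ball 0 1. f x = c"
    using assms(1) by (intro has_field_derivative_zero_constant)
      (auto intro: has_field_derivative_at_within)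
  then show ?thesis
    using assms(2) by force
qed

text \<open>In the coordinate \<open>v = Arcsin t\<close> the operator \<open>(1 - t\<^sup>2) f'' - t f'\<close> is the second
  derivative, since \<open>cos v \<cdot> d/dt\<close> is \<open>d/dv\<close>.\<close>

lemma Arcsin_ode_solution:
  fixes f f' f'' h H K :: "complex \<Rightarrow> complex"
  assumes f: "\<And>t. norm t < 1 \<Longrightarrow> (f has_field_derivative f' t) (at t)"
    and f': "\<And>t. norm t < 1 \<Longrightarrow> (f' has_field_derivative f'' t) (at t)"
    and ode: "\<And>t. norm t < 1 \<Longrightarrow> (1 - t\<^sup>2) * f'' t - t * f' t = h t"
    and H: "\<And>t. norm t < 1 \<Longrightarrow> (H has_field_derivative h t / cos (Arcsin t)) (at t)"
    and K: "\<And>t. norm t < 1 \<Longrightarrow> (K has_field_derivative H t / cos (Arcsin t)) (at t)"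
    and init: "f 0 = K 0" "f' 0 = H 0"
    and "norm t < 1"
  shows "f t = K t"
proof -
  \<comment> \<open>\<open>f' t * cos (Arcsin t)\<close> is the derivative of \<open>f\<close> in
    the coordinate \<open>v\<close>. By the differential equation its own derivative in
    \<open>t\<close> is \<open>h t / cos (Arcsin t)\<close>, the same as that of
    \<open>H\<close>.\<close>
  have first: "f' t * cos (Arcsin t) = H t" if "norm t < 1" for t
  proof -
    have "((\<lambda>t. f' t * cos (Arcsin t) - H t) has_field_derivative 0) (at u)"
      if u: "norm u < 1" for u
    proof -
      have c: "cos (Arcsin u) \<noteq> 0"
        using cos_Arcsin_nonzero u by blast
      have "f'' u * (cos (Arcsin u))\<^sup>2 - u * f' u = h u"
        using ode[OF u] by (simp add: cos_Arcsin_squared mult.commute)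
      then show ?thesis
        using c by (auto intro!: derivative_eq_intros f'[OF u] H[OF u] Arcsin_domain[OF u]
            simp: field_simps power2_eq_square)
    qed
    from zero_derivative_ball[OF this \<open>norm t < 1\<close>] show ?thesis
      using init by simp
  qed
  have "((\<lambda>t. f t - K t) has_field_derivative 0) (at u)" if u: "norm u < 1" for u
    using first[OF u] cos_Arcsin_nonzero[OF u]
    by (auto intro!: derivative_eq_intros f[OF u] K[OF u] simp: field_simps)
  from zero_derivative_ball[OF this \<open>norm t < 1\<close>] show ?thesis
    using init by simp
qed

text \<open>Comparison of coefficients: F'' - X^2 F'' - X F' has n-th coefficient (n+1)(n+2) F_(n+2)
  - (n(n-1) + n) F_n, where n(n-1) + n = n^2. A radius of at least 1 allows each summand to be
  evaluated separately.\<close>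

lemma eval_fps_Arcsin_operator:
  fixes F G :: "complex fps"
  assumes rF: "1 \<le> fps_conv_radius F"
    and rec: "\<And>n. of_nat ((n + 1) * (n + 2)) * fps_nth F (n + 2)
                    = of_nat (n\<^sup>2) * fps_nth F n + fps_nth G n"
    and t: "norm t < 1"
  shows "(1 - t\<^sup>2) * eval_fps (fps_deriv (fps_deriv F)) t - t * eval_fps (fps_deriv F) t
         = eval_fps G t"
proof -
  let ?D1 = "fps_deriv F" and ?D2 = "fps_deriv (fps_deriv F)"
  have r1: "1 \<le> fps_conv_radius ?D1"
    using rF fps_conv_radius_deriv[of F] by (meson order_trans)
  have r2: "1 \<le> fps_conv_radius ?D2"
    using r1 fps_conv_radius_deriv[of ?D1] by (meson order_trans)
  have t': "ereal (norm t) < 1"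
    using t by simp
  have "?D2 - fps_X ^ 2 * ?D2 - fps_X * ?D1 = G"
  proof (rule fps_ext)
    fix n
    have "fps_nth ?D2 n = of_nat ((n + 1) * (n + 2)) * fps_nth F (n + 2)"
      by (simp add: algebra_simps)
    moreover have "fps_nth (fps_X ^ 2 * ?D2) n = of_nat (n * (n - 1)) * fps_nth F n"
    proof (cases "n < 2")
      case True
      then show ?thesis
        by (auto simp: fps_X_power_mult_nth less_2_cases_iff)
    next
      case False
      then obtain m where "n = Suc (Suc m)"
        by (metis add_2_eq_Suc le_Suc_ex linorder_not_less)
      then show ?thesis
        by (simp add: fps_X_power_mult_nth algebra_simps fps_X_power_mult_right_nth)
    qed
    moreover have "fps_nth (fps_X * ?D1) n = of_nat n * fps_nth F n"
      by (cases n) simp_all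
    moreover have "n\<^sup>2 = n * (n - 1) + n"
      by (cases n) (simp_all add: power2_eq_square)
    ultimately show "fps_nth (?D2 - fps_X ^ 2 * ?D2 - fps_X * ?D1) n = fps_nth G n"
      using rec[of n] by (simp only: fps_sub_nth of_nat_add distrib_right)
        (simp add: algebra_simps)
  qed
  moreover have rX2: "1 \<le> fps_conv_radius (fps_X ^ 2 * ?D2)"
    using r2 fps_conv_radius_mult[of "fps_X ^ 2" ?D2] by (simp add: min_def split: if_splits)
  moreover have rX1: "1 \<le> fps_conv_radius (fps_X * ?D1)"
    using r1 fps_conv_radius_mult[of "fps_X" ?D1] by (simp add: min_def split: if_splits)
  moreover have "1 \<le> fps_conv_radius (?D2 - fps_X ^ 2 * ?D2)"
    using r2 rX2 fps_conv_radius_diff[of ?D2 "fps_X ^ 2 * ?D2"]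
    by (metis min.boundedI order_trans)
  ultimately have "eval_fps G t
      = eval_fps ?D2 t - eval_fps (fps_X ^ 2 * ?D2) t - eval_fps (fps_X * ?D1) t"
    using t' r2 by (metis (no_types, lifting) eval_fps_diff less_le_trans)
  also have "eval_fps (fps_X ^ 2 * ?D2) t = t\<^sup>2 * eval_fps ?D2 t"
    using less_le_trans[OF t' r2] by (subst eval_fps_mult) simp_all
  also have "eval_fps (fps_X * ?D1) t = t * eval_fps ?D1 t"
    using less_le_trans[OF t' r1] by (subst eval_fps_mult) simp_all
  finally show ?thesis
    by (simp add: algebra_simps)
qed

section \<open>Coefficients, recurrences and summability\<close>

definition arcsin_coeff :: "nat \<Rightarrow> real" where
  "arcsin_coeff k = real ((2 * k) choose k) / (4 ^ k * (2 * real k + 1))"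

text \<open>The coefficient of t^(2k+1) in Arcsin^3 t / 6, as shown below. The inner sum stops
  before \<open>k\<close>, so the coefficient of t is 0.\<close>

definition arcsin3_coeff :: "nat \<Rightarrow> real" where
  "arcsin3_coeff k = arcsin_coeff k * (\<Sum>j<k. 1 / (2 * real j + 1)\<^sup>2)"

lemma central_binomial_Suc:
  "(real k + 1) * real ((2 * Suc k) choose Suc k) = 2 * (2 * real k + 1) * real ((2 * k) choose k)"
proof -
  have "2 * Suc k - Suc k = Suc k"
    by simp
  then have "real ((2 * Suc k) choose Suc k) = fact (2 * Suc k) / (fact (Suc k) * fact (Suc k))"
    by (metis binomial_fact le_add1 mult_2)
  also have "fact (2 * Suc k) = 2 * (real k + 1) * (2 * real k + 1) * fact (2 * k)"
    by (simp add: algebra_simps)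
  also have "fact (2 * k) = real ((2 * k) choose k) * (fact k * fact k)"
    by (simp add: binomial_fact)
  also have "fact (Suc k) = (real k + 1) * fact k"
    by (simp add: algebra_simps)
  finally have P: "real ((2 * Suc k) choose Suc k) = 2 * (real k + 1) * (2 * real k + 1)
      * (real ((2 * k) choose k) * (fact k * fact k)) / (((real k + 1) * fact k) * ((real k + 1) * fact k))" .
  have cancel: "a * (2 * a * b * (c * (f * f)) / ((a * f) * (a * f))) = 2 * b * c"
    if "a \<noteq> 0" "f \<noteq> 0" for a b c f :: real
    using that by simp
  show ?thesis
    unfolding P by (rule cancel) simp_all
qed

lemma arcsin_coeff_nonneg: "0 \<le> arcsin_coeff k"
  by (simp add: arcsin_coeff_def)

text \<open>This is the recurrence of (1 - t^2) f'' - t f' = 0 at degree 2k+1; it reduces to the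
  ratio of consecutive central binomial coefficients.\<close>

lemma arcsin_coeff_Suc:
  "(2 * real k + 2) * (2 * real k + 3) * arcsin_coeff (Suc k) = (2 * real k + 1)\<^sup>2 * arcsin_coeff k"
proof -
  have "(2 * real k + 2) * (2 * real k + 3) * arcsin_coeff (Suc k)
        = 2 * ((real k + 1) * real ((2 * Suc k) choose Suc k)) / (4 * 4 ^ k)"
    by (simp add: arcsin_coeff_def divide_simps del: binomial_Suc_Suc) (simp add: algebra_simps)
  also have "\<dots> = (2 * real k + 1)\<^sup>2 * arcsin_coeff k"
    unfolding central_binomial_Suc by (simp add: arcsin_coeff_def power2_eq_square divide_simps)
  finally show ?thesis .
qed

text \<open>The new summand 1/(2k+1)^2 of the inner sum cancels the factor (2k+1)^2 and leaves one
  copy of \<open>arcsin_coeff k\<close>. This term is the right side of (1 - t^2) f'' - t f' =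
  Arcsin t.\<close>

lemma arcsin3_coeff_Suc:
  "(2 * real k + 2) * (2 * real k + 3) * arcsin3_coeff (Suc k)
   = (2 * real k + 1)\<^sup>2 * arcsin3_coeff k + arcsin_coeff k"
proof -
  let ?S = "\<lambda>k. \<Sum>j<k. 1 / (2 * real j + 1)\<^sup>2"
  have "(2 * real k + 1)\<^sup>2 * ?S (Suc k) = (2 * real k + 1)\<^sup>2 * ?S k + 1"
    by (simp add: field_simps)
  then have "((2 * real k + 1)\<^sup>2 * arcsin_coeff k) * ?S (Suc k)
             = (2 * real k + 1)\<^sup>2 * arcsin3_coeff k + arcsin_coeff k"
    unfolding arcsin3_coeff_def mult.assoc[symmetric] mult.commute[of "(2 * real k + 1)\<^sup>2" "arcsin_coeff k"]
    unfolding mult.assoc by (simp only: distrib_left mult_1_right)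
  then show ?thesis
    by (simp add: arcsin3_coeff_def arcsin_coeff_Suc[symmetric] del: sum.lessThan_Suc)
qed

text \<open>With \<open>\<beta>\<^sub>k = (2k choose k) / 4\<^sup>k\<close> one has \<open>\<beta>\<^sub>k - \<beta>\<^bsub>k+1\<^esub> = \<beta>\<^sub>k / (2k + 2)\<close>, so that the
  coefficients are dominated by the telescoping series of \<open>2 (\<beta>\<^sub>k - \<beta>\<^bsub>k+1\<^esub>)\<close>.\<close>

lemma summable_arcsin_coeff: "summable arcsin_coeff"
proof -
  define \<beta> where "\<beta> k = real ((2 * k) choose k) / 4 ^ k" for k
  have step: "(2 * real k + 2) * \<beta> (Suc k) = (2 * real k + 1) * \<beta> k" for k
  proof -
    have "(2 * real k + 2) * \<beta> (Suc k)
          = 2 * ((real k + 1) * real ((2 * Suc k) choose Suc k)) / (4 * 4 ^ k)"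
      by (simp add: \<beta>_def algebra_simps add_divide_distrib del: binomial_Suc_Suc)
    then show ?thesis
      unfolding central_binomial_Suc by (simp add: \<beta>_def field_simps del: binomial_Suc_Suc)
  qed
  have "arcsin_coeff k \<le> 2 * (\<beta> k - \<beta> (Suc k))" for k
  proof -
    have "\<beta> (Suc k) = (2 * real k + 1) * \<beta> k / (2 * real k + 2)"
      using step[of k] by (simp add: eq_divide_eq mult.commute)
    then have "2 * (\<beta> k - \<beta> (Suc k)) = \<beta> k / (real k + 1)"
      by (simp add: divide_simps) (simp add: algebra_simps)
    moreover have "arcsin_coeff k = \<beta> k / (2 * real k + 1)"
      by (simp add: arcsin_coeff_def \<beta>_def)
    moreover have "\<beta> k \<ge> 0"
      by (simp add: \<beta>_def)
    ultimately show ?thesis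
      by (simp add: frac_le)
  qed
  then have "(\<Sum>k<n. arcsin_coeff k) \<le> (\<Sum>k<n. 2 * (\<beta> k - \<beta> (Suc k)))" for n
    by (intro sum_mono)
  also have "(\<Sum>k<n. 2 * (\<beta> k - \<beta> (Suc k))) = 2 * (\<beta> 0 - \<beta> n)" for n
    unfolding sum_distrib_left[symmetric] sum_lessThan_telescope' ..
  also have "2 * (\<beta> 0 - \<beta> n) \<le> 2" for n
    by (simp add: \<beta>_def)
  finally show ?thesis
    by (intro summableI_nonneg_bounded arcsin_coeff_nonneg)
qed

text \<open>The induction runs on the sharper bound 2 - 1/(k+1), whose increments 1/((k+1)(k+2))
  dominate all summands but the first.\<close>

lemma sum_odd_inverse_squares_le: "(\<Sum>j<k. 1 / (2 * real j + 1)\<^sup>2) \<le> 2"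
proof -
  have "(\<Sum>j<k. 1 / (2 * real j + 1)\<^sup>2) \<le> 2 - 1 / (real k + 1)"
  proof (induction k)
    case (Suc k)
    \<comment> \<open>The first summand 1 exceeds its increment by 1/2; the slack at k = 0, where
      the sum is 0 and the bound is 1, absorbs this.\<close>
    have "1 / (2 * real k + 1)\<^sup>2 \<le> 1 / ((real k + 1) * (real k + 2)) + (if k = 0 then 1/2 else 0)"
    proof (cases k)
      case (Suc m)
      have "(real k + 1) * (real k + 2) \<le> (2 * real k + 1)\<^sup>2"
        by (simp add: Suc power2_eq_square algebra_simps)
      then show ?thesis
        by (simp add: Suc frac_le)
    qed auto
    moreover have "1 / ((real k + 1) * (real k + 2)) = 1 / (real k + 1) - 1 / (real (Suc k) + 1)"
      by (simp add: divide_simps)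
    ultimately show ?case
      using Suc by (cases "k = 0") auto
  qed auto
  also have "\<dots> \<le> 2"
    by simp
  finally show ?thesis .
qed

lemma arcsin3_coeff_nonneg: "0 \<le> arcsin3_coeff k"
  by (auto simp: arcsin3_coeff_def arcsin_coeff_nonneg intro!: mult_nonneg_nonneg sum_nonneg)

lemma summable_arcsin3_coeff: "summable arcsin3_coeff"
proof (rule summable_comparison_test')
  show "summable (\<lambda>k. 2 * arcsin_coeff k)"
    by (intro summable_mult summable_arcsin_coeff)
  show "norm (arcsin3_coeff k) \<le> 2 * arcsin_coeff k" for k
    using mult_left_mono[OF sum_odd_inverse_squares_le[of k] arcsin_coeff_nonneg[of k]] arcsin3_coeff_nonneg[of k]
    by (simp add: arcsin3_coeff_def mult.commute)
qed

section \<open>Odd power series and their identification through the differential equation\<close>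

definition odd_fps :: "(nat \<Rightarrow> real) \<Rightarrow> complex fps" where
  "odd_fps c = Abs_fps (\<lambda>n. if odd n then of_real (c (n div 2)) else 0)"

lemma sums_odd_fps_iff:
  "(\<lambda>n. fps_nth (odd_fps c) n * t ^ n) sums s \<longleftrightarrow> (\<lambda>k. of_real (c k) * t ^ (2 * k + 1)) sums s"
proof -
  have "(\<lambda>k. fps_nth (odd_fps c) (2 * k + 1) * t ^ (2 * k + 1)) sums s
        \<longleftrightarrow> (\<lambda>n. fps_nth (odd_fps c) n * t ^ n) sums s"
    by (intro sums_mono_reindex) (auto simp: strict_mono_def odd_fps_def elim!: oddE)
  then show ?thesis
    by (simp add: odd_fps_def)
qed

lemma norm_odd_power_le:
  fixes t :: complex
  assumes "norm t \<le> 1" "0 \<le> (c::real)"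
  shows "norm (of_real c * t ^ (2 * k + 1)) \<le> c"
  using power_le_one[of "norm t" "2 * k + 1"] assms
  by (simp add: norm_mult norm_power mult_left_le del: power_Suc)

lemma summable_odd_series:
  assumes "summable c" "\<And>k. 0 \<le> c k" "norm t \<le> 1"
  shows "summable (\<lambda>k. complex_of_real (c k) * t ^ (2 * k + 1))"
  using assms by (intro summable_comparison_test'[OF assms(1)] norm_odd_power_le)

text \<open>Convergence at the single boundary point 1 already forces a radius of at least
  1.\<close>

lemma odd_fps_conv_radius:
  assumes "summable c" "\<And>k. 0 \<le> c k"
  shows "1 \<le> fps_conv_radius (odd_fps c)"
proof -
  have "summable (\<lambda>k. complex_of_real (c k) * 1 ^ (2 * k + 1))"
    using summable_odd_series[OF assms, of 1] by simp
  then have "summable (\<lambda>n. fps_nth (odd_fps c) n * 1 ^ n)"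
    unfolding summable_def sums_odd_fps_iff .
  from conv_radius_geI[OF this] show ?thesis
    by (simp add: fps_conv_radius_def one_ereal_def)
qed

lemma odd_series_sums_eval_fps:
  assumes "summable c" "\<And>k. 0 \<le> c k" "norm t < 1"
  shows "(\<lambda>k. complex_of_real (c k) * t ^ (2 * k + 1)) sums eval_fps (odd_fps c) t"
proof -
  have "ereal (norm t) < fps_conv_radius (odd_fps c)"
    using odd_fps_conv_radius[OF assms(1,2)] assms(3)
    by (metis ereal_less(3) less_le_trans)
  then show ?thesis
    unfolding eval_fps_def sums_odd_fps_iff[symmetric] by (intro summable_sums summable_fps)
qed

text \<open>At degree n = 2k+1 the recurrence for \<open>c\<close> is the differential equation with
  right side \<open>h\<close>; at even degrees both sides vanish. \<open>H\<close> and
  \<open>K\<close> are successive primitives of \<open>h\<close> in the coordinate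
  \<open>v = Arcsin t\<close>, with the initial values of the series.\<close>

lemma eval_odd_fps_ode_solution:
  fixes h H K :: "complex \<Rightarrow> complex"
  assumes c: "summable c" "\<And>k. 0 \<le> c k"
    and rec: "\<And>k. (2 * real k + 2) * (2 * real k + 3) * c (Suc k) = (2 * real k + 1)\<^sup>2 * c k + d k"
    and h: "\<And>t. norm t < 1 \<Longrightarrow> eval_fps (odd_fps d) t = h t"
    and H: "\<And>t. norm t < 1 \<Longrightarrow> (H has_field_derivative h t / cos (Arcsin t)) (at t)"
    and K: "\<And>t. norm t < 1 \<Longrightarrow> (K has_field_derivative H t / cos (Arcsin t)) (at t)"
    and init: "K 0 = 0" "H 0 = c 0"
    and "norm t < 1"
  shows "eval_fps (odd_fps c) t = K t"
proof (rule Arcsin_ode_solution[OF _ _ _ H K])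
  let ?F = "odd_fps c"
  have r: "1 \<le> fps_conv_radius ?F"
    by (rule odd_fps_conv_radius[OF c])
  have r1: "1 \<le> fps_conv_radius (fps_deriv ?F)"
    using r fps_conv_radius_deriv[of ?F] by (meson order_trans)
  show "(eval_fps ?F has_field_derivative eval_fps (fps_deriv ?F) u) (at u)" if "norm u < 1" for u
    using that less_le_trans[OF _ r] by (intro has_field_derivative_eval_fps) auto
  show "(eval_fps (fps_deriv ?F) has_field_derivative eval_fps (fps_deriv (fps_deriv ?F)) u) (at u)"
    if "norm u < 1" for u
    using that less_le_trans[OF _ r1] by (intro has_field_derivative_eval_fps) auto
  show "(1 - u\<^sup>2) * eval_fps (fps_deriv (fps_deriv ?F)) u - u * eval_fps (fps_deriv ?F) u = h u"
    if "norm u < 1" for u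
    unfolding h[OF that, symmetric]
  proof (rule eval_fps_Arcsin_operator[OF r _ that])
    fix n
    show "of_nat ((n + 1) * (n + 2)) * fps_nth ?F (n + 2) = of_nat (n\<^sup>2) * fps_nth ?F n + fps_nth (odd_fps d) n"
    proof (cases "odd n")
      case True
      then obtain k where k: "n = 2 * k + 1"
        by (elim oddE)
      have "complex_of_real ((2 * real k + 2) * (2 * real k + 3) * c (Suc k))
            = complex_of_real ((2 * real k + 1)\<^sup>2 * c k + d k)"
        using rec[of k] by simp
      moreover have "of_nat ((n + 1) * (n + 2))
          = (2 * complex_of_nat k + 2) * (2 * complex_of_nat k + 3)"
        by (simp add: k algebra_simps)
      moreover have "of_nat (n\<^sup>2) = (2 * complex_of_nat k + 1)\<^sup>2"
        by (simp add: k add.commute)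
      ultimately show ?thesis
        by (simp add: k odd_fps_def)
    qed (simp add: odd_fps_def)
  qed
  show "eval_fps ?F 0 = K 0" "eval_fps (fps_deriv ?F) 0 = H 0"
    using init by (simp_all add: eval_fps_at_0 odd_fps_def)
qed (use assms in auto)

lemma eval_arcsin_series:
  assumes "norm t < 1"
  shows "eval_fps (odd_fps arcsin_coeff) t = Arcsin t"
proof (rule eval_odd_fps_ode_solution[OF summable_arcsin_coeff arcsin_coeff_nonneg _ _ _ _ _ _ assms,
      where d = "\<lambda>_. 0" and h = "\<lambda>_. 0" and H = "\<lambda>_. 1"])
  show "(Arcsin has_field_derivative 1 / cos (Arcsin u)) (at u)" if "norm u < 1" for u
    using has_field_derivative_Arcsin[OF Arcsin_domain[OF that]] by (simp add: field_simps)
  show "eval_fps (odd_fps (\<lambda>_. 0)) u = 0" if "norm u < 1" for u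
    by (simp add: eval_fps_def odd_fps_def cong: if_cong)
  show "1 = complex_of_real (arcsin_coeff 0)"
    by (simp add: arcsin_coeff_def)
qed (use arcsin_coeff_Suc in auto)

text \<open>In the coordinate \<open>v\<close> the right side is v, the previous series, and its
  successive primitives are v^2/2 and v^3/6.\<close>

lemma eval_arcsin3_series:
  assumes "norm t < 1"
  shows "eval_fps (odd_fps arcsin3_coeff) t = Arcsin t ^ 3 / 6"
proof (rule eval_odd_fps_ode_solution[OF summable_arcsin3_coeff arcsin3_coeff_nonneg _ _ _ _ _ _ assms,
      where d = arcsin_coeff and h = Arcsin and H = "\<lambda>t. (Arcsin t)\<^sup>2 / 2"])
  fix u :: complex
  assume u: "norm u < 1"
  show "((\<lambda>t. (Arcsin t)\<^sup>2 / 2) has_field_derivative Arcsin u / cos (Arcsin u)) (at u)"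
    by (auto intro!: derivative_eq_intros Arcsin_domain[OF u] simp: field_simps)
  show "((\<lambda>t. Arcsin t ^ 3 / 6) has_field_derivative (Arcsin u)\<^sup>2 / 2 / cos (Arcsin u)) (at u)"
    by (auto intro!: derivative_eq_intros Arcsin_domain[OF u] simp: field_simps)
next
  show "(Arcsin 0)\<^sup>2 / 2 = complex_of_real (arcsin3_coeff 0)"
    by (simp add: arcsin3_coeff_def)
qed (use arcsin3_coeff_Suc eval_arcsin_series in auto)

section \<open>Extension to the closed unit disc\<close>

lemma tendsto_Arcsin_radial:
  assumes "norm t \<le> 1"
  shows "((\<lambda>r. Arcsin (of_real r * t)) \<longlongrightarrow> Arcsin t) (at_left 1)"
proof (cases "Im t = 0")
  \<comment> \<open>At the branch points 1 and -1 \<open>Arcsin\<close> is not holomorphic. For real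
    \<open>t\<close> the radial limit comes from the real \<open>arcsin\<close>, which is continuous
    up to both ends of [-1, 1].\<close>
  case True
  then obtain \<tau> where \<tau>: "t = of_real \<tau>"
    by (metis complex_is_Real_iff Reals_cases)
  then have le: "\<bar>\<tau>\<bar> \<le> 1"
    using assms by simp
  have bound: "\<bar>r * \<tau>\<bar> \<le> 1" if "r \<in> {0..1}" for r
    using that le by (simp add: abs_mult mult_le_one)
  have "continuous_on {0..1} (\<lambda>r. arcsin (r * \<tau>))"
    using bound by (intro continuous_on_arcsin continuous_intros) (force simp: abs_le_iff)+
  then have "((\<lambda>r. arcsin (r * \<tau>)) \<longlongrightarrow> arcsin (1 * \<tau>)) (at 1 within {0..1})"
    unfolding continuous_on by (rule bspec) simp
  then have lim: "((\<lambda>r. complex_of_real (arcsin (r * \<tau>))) \<longlongrightarrow> of_real (arcsin (1 * \<tau>))) (at_left 1)"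
    by (simp add: at_within_Icc_at_left tendsto_of_real)
  have "eventually (\<lambda>r::real. 0 < r \<and> r < 1) (at_left 1)"
    by (auto intro!: eventually_conj eventually_at_left_1 eventually_at_leftI[of 0])
  then have "eventually (\<lambda>r. complex_of_real (arcsin (r * \<tau>)) = Arcsin (of_real r * t)) (at_left 1)"
  proof eventually_elim
    case (elim r)
    then show ?case
      using bound[of r] \<tau> of_real_arcsin[of "r * \<tau>"] by simp
  qed
  moreover have "complex_of_real (arcsin (1 * \<tau>)) = Arcsin t"
    using le \<tau> by (simp add: of_real_arcsin)
  ultimately show ?thesis
    using lim by (simp add: tendsto_cong)
next
  case False
  then have "isCont (\<lambda>r. Arcsin (of_real r * t)) 1"
    by (intro isCont_Arcsin') auto
  then show ?thesis
    by (auto simp: isCont_def intro: tendsto_within_subset)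
qed

text \<open>Summable coefficients make the series continuous on the closed disc by the Weierstrass
  test, so the identity inside passes to the boundary along radii. The boundary is reached when |x|
  = 1/4.\<close>

lemma Arcsin_cubed_series:
  assumes "norm t \<le> 1"
  shows "(\<lambda>k. complex_of_real (arcsin3_coeff k) * t ^ (2 * k + 1)) sums (Arcsin t ^ 3 / 6)"
proof -
  define f where "f s = (\<Sum>k. complex_of_real (arcsin3_coeff k) * s ^ (2 * k + 1))" for s
  have "uniform_limit (cball 0 1) (\<lambda>n s. \<Sum>k<n. complex_of_real (arcsin3_coeff k) * s ^ (2 * k + 1)) f sequentially"
    unfolding f_def
    by (intro Weierstrass_m_test[OF _ summable_arcsin3_coeff] norm_odd_power_le arcsin3_coeff_nonneg)
      simp
  then have contf: "continuous_on (cball 0 1) f"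
    by (rule uniform_limit_theorem[rotated]) (auto intro!: always_eventually continuous_intros)
  have eq: "f s = Arcsin s ^ 3 / 6" if "norm s < 1" for s
    using sums_unique[OF odd_series_sums_eval_fps[OF summable_arcsin3_coeff arcsin3_coeff_nonneg that]]
      eval_arcsin3_series[OF that] by (simp add: f_def)
  have "continuous_on {0..1} (\<lambda>r. f (of_real r * t))"
    using assms by (intro continuous_on_compose2[OF contf] continuous_intros)
      (auto simp: norm_mult mult_le_one)
  then have "((\<lambda>r. f (of_real r * t)) \<longlongrightarrow> f (of_real 1 * t)) (at 1 within {0..1})"
    unfolding continuous_on by (rule bspec) simp
  then have "((\<lambda>r. f (of_real r * t)) \<longlongrightarrow> f t) (at_left 1)"
    by (simp add: at_within_Icc_at_left)
  moreover have "eventually (\<lambda>r::real. 0 < r \<and> r < 1) (at_left 1)"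
    by (auto intro!: eventually_at_leftI[of 0])
  then have "eventually (\<lambda>r. f (of_real r * t) = Arcsin (of_real r * t) ^ 3 / 6) (at_left 1)"
  proof eventually_elim
    case (elim r)
    have "norm (of_real r * t) \<le> r * 1"
      using elim assms by (auto simp: norm_mult intro!: mult_left_mono)
    then show ?case
      using elim by (intro eq) auto
  qed
  ultimately have "((\<lambda>r. Arcsin (of_real r * t) ^ 3 / 6) \<longlongrightarrow> f t) (at_left 1)"
    by (simp add: tendsto_cong)
  moreover have "((\<lambda>r. Arcsin (of_real r * t) ^ 3 / 6) \<longlongrightarrow> Arcsin t ^ 3 / 6) (at_left 1)"
    by (intro tendsto_intros tendsto_Arcsin_radial assms) auto
  ultimately have "f t = Arcsin t ^ 3 / 6"
    by (intro tendsto_unique[of "at_left (1::real)"]) auto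
  then show ?thesis
    using summable_sums[OF summable_odd_series[OF summable_arcsin3_coeff arcsin3_coeff_nonneg assms]]
    unfolding f_def by (metis (lifting))
qed

subsection \<open>Principal branches\<close>

text \<open>On the edges of the strip |sin v| is at least cosh (Im v), so the norm bound leaves only
  the real points of the edges, where the principal branch still inverts sine.\<close>

lemma Arcsin_sin_closed:
  assumes "\<bar>Re v\<bar> \<le> pi / 2" "norm (sin v) \<le> 1"
  shows "Arcsin (sin v) = v"
proof (rule Arcsin_sin)
  have "Im v = 0" if "\<bar>Re v\<bar> = pi / 2"
  proof -
    have "Re v = pi / 2 \<or> Re v = - (pi / 2)"
      using that by linarith
    then have "\<bar>sin (Re v)\<bar> = 1"
      by (elim disjE) (simp_all only: sin_minus sin_pi_half abs_minus_cancel abs_one)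
    then have "\<bar>Re (sin v)\<bar> = cosh (Im v)"
      by (simp add: Re_sin abs_mult cosh_field_def)
    then have "cosh (Im v) \<le> 1"
      using abs_Re_le_cmod[of "sin v"] assms(2) by simp
    then show ?thesis
      using cosh_real_one_iff[of "Im v"] cosh_real_ge_1[of "Im v"] by linarith
  qed
  then show "\<bar>Re v\<bar> < pi / 2 \<or> \<bar>Re v\<bar> = pi / 2 \<and> Im v = 0"
    using assms(1) by linarith
qed

text \<open>Both definitions take the logarithm of the same quotient (1 + u) / (1 - u), so no branch
  correction arises.\<close>

lemma Arctan_i_times: "Arctan (\<i> * u) = \<i> * artanh u"
  by (simp add: Arctan_def artanh_def mult.assoc[symmetric])

lemma Arctan_denominators_nonzero:
  assumes "u\<^sup>2 \<noteq> (-1::complex)"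
  shows "1 + \<i> * u \<noteq> 0" "1 - \<i> * u \<noteq> 0"
proof -
  have "(1 + \<i> * u) * (1 - \<i> * u) = 1 + u\<^sup>2"
    by (simp add: algebra_simps power2_eq_square)
  moreover have "1 + u\<^sup>2 \<noteq> 0"
    using assms by (simp add: add_eq_0_iff minus_equation_iff)
  ultimately show "1 + \<i> * u \<noteq> 0" "1 - \<i> * u \<noteq> 0"
    by auto
qed

text \<open>The Moebius map u -> (1 - iu) / (1 + iu) sends the unit disc to the right half-plane,
  where arguments are at most pi/2 in modulus; \<open>Arctan\<close> halves them.\<close>

lemma abs_Re_Arctan_le:
  assumes "norm u \<le> 1" "u\<^sup>2 \<noteq> -1"
  shows "\<bar>Re (Arctan u)\<bar> \<le> pi / 4"
proof -
  let ?m = "(1 - \<i> * u) / (1 + \<i> * u)"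
  have "?m \<noteq> 0"
    using Arctan_denominators_nonzero[OF assms(2)] by simp
  moreover have "(Re u)\<^sup>2 + (Im u)\<^sup>2 \<le> 1"
    using assms(1) by (metis cmod_power2 norm_ge_zero one_power2 power_mono)
  then have "0 \<le> Re ?m"
    by (simp add: Re_complex_div_ge_0 algebra_simps power2_eq_square)
  ultimately have "\<bar>Im (Ln ?m)\<bar> \<le> pi / 2"
    using Re_Ln_pos_le[of ?m] by blast
  moreover have "Re (Arctan u) = - Im (Ln ?m) / 2"
    by (simp add: Arctan_def)
  ultimately show ?thesis
    by (simp add: abs_le_iff)
qed

lemma sin_cos_Arctan:
  assumes "u\<^sup>2 \<noteq> (-1::complex)"
  shows "sin (Arctan u) = u * cos (Arctan u)" "(cos (Arctan u))\<^sup>2 * (1 + u\<^sup>2) = 1"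
proof -
  have tan: "sin (Arctan u) / cos (Arctan u) = u"
    using tan_Arctan[OF assms] by (simp add: tan_def)
  \<comment> \<open>A vanishing cosine would make the quotient 0 by the convention for division by
    zero, hence u = 0; but there the cosine is 1.\<close>
  then have "cos (Arctan u) \<noteq> 0"
    by (cases "u = 0") auto
  with tan show sin: "sin (Arctan u) = u * cos (Arctan u)"
    by (simp add: field_simps)
  have "(u * cos (Arctan u))\<^sup>2 + (cos (Arctan u))\<^sup>2 = 1"
    unfolding sin[symmetric] by simp
  then show "(cos (Arctan u))\<^sup>2 * (1 + u\<^sup>2) = 1"
    by (simp add: algebra_simps power_mult_distrib)
qed

lemma Re_cos_nonneg: "\<bar>Re v\<bar> \<le> pi / 2 \<Longrightarrow> 0 \<le> Re (cos v)"
  by (auto simp: Re_cos abs_le_iff intro!: mult_nonneg_nonneg cos_ge_zero)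

text \<open>The condition on \<open>c\<^sup>2\<close> keeps \<open>c\<close> off the imaginary axis,
  so Re c > 0. If q c were the other root of 2, multiplication by the conjugate of \<open>c\<close>
  would give \<open>q\<close> a negative real part.\<close>

lemma csqrt_mult_eq_csqrt_2:
  assumes "(q * c)\<^sup>2 = 2" "0 \<le> Re q" "0 \<le> Re c" "0 < Re (c\<^sup>2)"
  shows "q * c = csqrt 2"
proof (rule ccontr)
  assume "q * c \<noteq> csqrt 2"
  moreover have "(q * c)\<^sup>2 = (csqrt 2)\<^sup>2"
    unfolding assms(1) power2_csqrt ..
  ultimately have qc: "q * c = - csqrt 2"
    using power2_eq_iff by blast
  have "Re c \<noteq> 0"
    using assms(4) by (auto simp: Re_power2)
  then have "0 < Re c"
    using assms(3) by simp
  have "q * of_real ((cmod c)\<^sup>2) = - csqrt 2 * cnj c"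
    unfolding complex_norm_square qc[symmetric] by (simp only: mult.assoc)
  from arg_cong[OF this, of Re] have "Re q * (cmod c)\<^sup>2 = - sqrt 2 * Re c"
    by (simp del: of_real_power)
  also have "\<dots> < 0"
    using \<open>0 < Re c\<close> by simp
  finally show False
    using assms(2) by (simp add: mult_less_0_iff)
qed

text \<open>Both roots lie in the same closed quadrant of the right half-plane, so their arguments
  differ by at most pi/2. Negative reals go with the upper half-plane, as in the principal
  root.\<close>

lemma csqrt_quotient_Re_nonneg:
  assumes "0 \<le> Im z \<longleftrightarrow> 0 \<le> Im x"
  shows "0 \<le> Re (csqrt z / csqrt x)"
proof -
  have sgn: "0 \<le> Im w \<Longrightarrow> 0 \<le> Im (csqrt w)" "Im w < 0 \<Longrightarrow> Im (csqrt w) \<le> 0" for w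
    using complex_Re_le_cmod[of w] by (auto simp: sgn_if)
  have "0 \<le> Im (csqrt z) * Im (csqrt x)"
    using assms sgn[of z] sgn[of x]
    by (metis linorder_not_le mult_nonneg_nonneg mult_nonpos_nonpos)
  moreover have "0 \<le> Re (csqrt z) * Re (csqrt x)"
    by (intro mult_nonneg_nonneg Re_csqrt)
  ultimately show ?thesis
    by (simp add: Re_complex_div_ge_0 del: csqrt.simps)
qed

text \<open>The roots of 2x(1 - z^2) = z have product -1, and Re r >= 0 selects the one in the
  closed unit disc: |r - 1| <= |r + 1|, while |r - 1| |r + 1| = 16 |x|^2. The claim on imaginary
  parts serves to compare the square roots of z and x.\<close>

lemma quadratic_root:
  fixes x z :: complex
  assumes "x \<noteq> 0" and z: "z = (csqrt (1 + 16 * x\<^sup>2) - 1) / (4 * x)"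
  shows "2 * x * (1 - z\<^sup>2) = z" "z \<noteq> 0" "z\<^sup>2 \<noteq> 1" "norm z \<le> 1" "0 \<le> Im z \<longleftrightarrow> 0 \<le> Im x"
proof -
  define r where "r = csqrt (1 + 16 * x\<^sup>2)"
  have r: "r\<^sup>2 = 1 + 16 * x\<^sup>2" "0 \<le> Re r"
    by (simp_all add: r_def Re_csqrt del: csqrt.simps)
  have rz: "r = 4 * x * z + 1"
    using assms by (simp add: r_def[symmetric])
  have "8 * x * (2 * x * (1 - z\<^sup>2) - z) = 0"
    using r(1) unfolding rz by (simp add: power2_eq_square algebra_simps)
  then show eq: "2 * x * (1 - z\<^sup>2) = z"
    using \<open>x \<noteq> 0\<close> by simp
  then show "z \<noteq> 0"
    using \<open>x \<noteq> 0\<close> by auto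
  then show z1: "z\<^sup>2 \<noteq> 1"
    using eq by auto
  have "(norm (r - 1))\<^sup>2 \<le> (norm (r + 1))\<^sup>2"
    unfolding cmod_power2 using r(2) by (simp add: power2_eq_square algebra_simps)
  then have "norm (r - 1) \<le> norm (r + 1)"
    by (rule power2_le_imp_le) simp
  then have "norm (r - 1) * norm (r - 1) \<le> norm (r + 1) * norm (r - 1)"
    by (intro mult_right_mono) auto
  also have "\<dots> = norm (r\<^sup>2 - 1)"
    unfolding norm_mult[symmetric] by (simp add: power2_eq_square algebra_simps)
  also have "\<dots> = (4 * norm x) * (4 * norm x)"
    unfolding r(1) by (simp add: norm_mult norm_power power2_eq_square)
  finally have "(norm (r - 1))\<^sup>2 \<le> (4 * norm x)\<^sup>2"
    unfolding power2_eq_square .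
  then have "norm (r - 1) \<le> 4 * norm x"
    by (rule power2_le_imp_le) simp
  then show "norm z \<le> 1"
    using \<open>x \<noteq> 0\<close> unfolding z r_def[symmetric] by (simp add: norm_divide norm_mult divide_le_eq)
  \<comment> \<open>Multiplying the quadratic relation by the conjugate of 1 - z^2 makes the factor
    of x real and positive, so imaginary parts can be compared.\<close>
  have "2 * x * of_real ((cmod (1 - z\<^sup>2))\<^sup>2) = z * cnj (1 - z\<^sup>2)"
    unfolding complex_norm_square by (subst (2) eq[symmetric]) (simp add: mult_ac)
  also have "\<dots> = z - of_real ((cmod z)\<^sup>2) * cnj z"
    unfolding complex_norm_square by (simp add: algebra_simps power2_eq_square)
  finally have "Im (2 * x * of_real ((cmod (1 - z\<^sup>2))\<^sup>2)) = Im (z - of_real ((cmod z)\<^sup>2) * cnj z)"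
    by simp
  then have "2 * (cmod (1 - z\<^sup>2))\<^sup>2 * Im x = (1 + (cmod z)\<^sup>2) * Im z"
    by (simp add: algebra_simps del: of_real_power)
  moreover have "0 < 2 * (cmod (1 - z\<^sup>2))\<^sup>2"
    using z1 by simp
  moreover have "0 < 1 + (cmod z)\<^sup>2"
    by (simp add: add_pos_nonneg)
  ultimately show "0 \<le> Im z \<longleftrightarrow> 0 \<le> Im x"
    by (metis zero_le_mult_iff less_le_not_le linorder_not_le)
qed

text \<open>The addition theorem gives \<open>sin (A \<plusminus> \<i> * B) = (1 \<plusminus> \<i>)
  * u * c\<close>. The quadratic relation determines \<open>u * c\<close> up to sign; the work lies
  in fixing this sign.\<close>

lemma Arctan_artanh_eq_Arcsin:
  fixes x z :: complex
  assumes "x \<noteq> 0" "norm x \<le> 1 / 4"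
    and z: "z = (csqrt (1 + 16 * x\<^sup>2) - 1) / (4 * x)"
  defines "A \<equiv> Arctan (csqrt z)" and "B \<equiv> artanh (csqrt z)"
  shows "Arcsin ((1 + \<i>) * csqrt 2 * csqrt x) = A + \<i> * B"
    and "Arcsin ((1 - \<i>) * csqrt 2 * csqrt x) = A - \<i> * B"
proof -
  define u where "u = csqrt z"
  define c where "c = cos A * cos (\<i> * B)"
  note root = quadratic_root[OF assms(1) z]
  have u2: "u\<^sup>2 = z"
    by (simp add: u_def del: csqrt.simps)
  have u: "u\<^sup>2 \<noteq> -1" "(\<i> * u)\<^sup>2 \<noteq> -1"
    using root(3) by (auto simp: u2 power_mult_distrib)
  have norm_u: "norm u \<le> 1"
    using root(4) by (simp add: u_def norm_csqrt del: csqrt.simps)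
  have iB: "\<i> * B = Arctan (\<i> * u)"
    by (simp add: Arctan_i_times u_def B_def)
  have sA: "sin A = u * cos A" "(cos A)\<^sup>2 * (1 + z) = 1"
    using sin_cos_Arctan[OF u(1)] by (simp_all only: A_def u_def power2_csqrt)
  have sB: "sin (\<i> * B) = \<i> * u * cos (\<i> * B)" "(cos (\<i> * B))\<^sup>2 * (1 - z) = 1"
    using sin_cos_Arctan[OF u(2)] unfolding iB by (simp_all add: power_mult_distrib u2)
  have Re_le: "\<bar>Re A\<bar> \<le> pi / 4" "\<bar>Re (\<i> * B)\<bar> \<le> pi / 4"
    using abs_Re_Arctan_le[OF norm_u u(1)] abs_Re_Arctan_le[OF _ u(2)] norm_u
    by (simp_all only: iB) (simp_all add: A_def u_def norm_mult)
  have Re_sum: "\<bar>Re (A + \<i> * B)\<bar> \<le> pi / 2" "\<bar>Re (A - \<i> * B)\<bar> \<le> pi / 2"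
    using Re_le unfolding plus_complex.sel minus_complex.sel by linarith+
  \<comment> \<open>As a half sum of cosines of points in the closed principal strip,
    \<open>c\<close> has nonnegative real part.\<close>
  have "2 * c = cos (A + \<i> * B) + cos (A - \<i> * B)"
    by (simp add: c_def cos_add cos_diff)
  from arg_cong[OF this, of Re]
  have "2 * Re c = Re (cos (A + \<i> * B)) + Re (cos (A - \<i> * B))"
    by simp
  then have Re_c: "0 \<le> Re c"
    using Re_cos_nonneg[OF Re_sum(1)] Re_cos_nonneg[OF Re_sum(2)] by linarith
  have c2: "c\<^sup>2 * (1 - z\<^sup>2) = 1"
  proof -
    have "c\<^sup>2 * (1 - z\<^sup>2) = ((cos A)\<^sup>2 * (1 + z)) * ((cos (\<i> * B))\<^sup>2 * (1 - z))"
      by (simp add: c_def power2_eq_square algebra_simps)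
    then show ?thesis
      unfolding sA(2) sB(2) by simp
  qed
  \<comment> \<open>In the closed unit disc Re (z^2) = 1 occurs only for z^2 = 1. Since
    \<open>c\<^sup>2\<close> is the inverse of 1 - z^2, it too lies in the open right
    half-plane.\<close>
  have "0 < Re (1 - z\<^sup>2)"
  proof -
    have le: "cmod (z\<^sup>2) \<le> 1"
      using root(4) by (simp add: norm_power power_le_one)
    have "Re (z\<^sup>2) \<noteq> 1"
    proof
      assume Re: "Re (z\<^sup>2) = 1"
      then have "Im (z\<^sup>2) = 0"
        using le cmod_power2[of "z\<^sup>2"] power_le_one[OF norm_ge_zero le, of 2] by simp
      with Re show False
        using root(3) by (simp add: complex_eq_iff)
    qed
    then show ?thesis
      using le complex_Re_le_cmod[of "z\<^sup>2"] by simp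
  qed
  moreover have "c\<^sup>2 = inverse (1 - z\<^sup>2)"
    using c2 by (metis inverse_unique mult.commute)
  moreover have "0 < Re (inverse w)" if "0 < Re w" for w
    using that by (simp add: add_pos_nonneg)
  ultimately have Re_c2: "0 < Re (c\<^sup>2)"
    by presburger
  have s: "csqrt x \<noteq> 0"
    using assms(1) by simp
  have "(u / csqrt x * c)\<^sup>2 = z * c\<^sup>2 / x"
    by (simp add: power_mult_distrib power_divide u2)
  also have "\<dots> = 2 * (c\<^sup>2 * (1 - z\<^sup>2))"
    by (subst root(1)[symmetric]) (use assms(1) in simp)
  finally have "u / csqrt x * c = csqrt 2"
    using csqrt_quotient_Re_nonneg[OF root(5)] Re_c Re_c2 c2
    by (intro csqrt_mult_eq_csqrt_2) (simp_all add: u_def del: csqrt.simps)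
  then have uc: "u * c = csqrt 2 * csqrt x"
    using s by (simp add: field_simps)
  have sin_eq: "sin (A + \<i> * B) = (1 + \<i>) * csqrt 2 * csqrt x"
    "sin (A - \<i> * B) = (1 - \<i>) * csqrt 2 * csqrt x"
    unfolding mult.assoc uc[symmetric] c_def sin_add sin_diff sA(1) sB(1)
    by (simp_all add: algebra_simps)
  \<comment> \<open>Both sines have norm 2 sqrt |x|, which is at most 1 exactly because |x| <=
    1/4.\<close>
  have "norm (1 + \<i>) = sqrt 2" "norm (1 - \<i>) = sqrt 2"
    by (simp_all add: cmod_def)
  moreover have "norm (csqrt x) \<le> 1 / 2"
    using assms(2) real_sqrt_le_mono[of "norm x" "1/4"] by (simp add: norm_csqrt real_sqrt_divide del: csqrt.simps)
  ultimately have "norm (sin (A + \<i> * B)) \<le> 1" "norm (sin (A - \<i> * B)) \<le> 1"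
    unfolding sin_eq by (simp_all add: norm_mult norm_csqrt del: csqrt.simps)
  with Re_sum show "Arcsin ((1 + \<i>) * csqrt 2 * csqrt x) = A + \<i> * B"
    "Arcsin ((1 - \<i>) * csqrt 2 * csqrt x) = A - \<i> * B"
    unfolding sin_eq[symmetric] by (simp_all only: Arcsin_sin_closed)
qed

subsection \<open>Even and odd parts\<close>

text \<open>The shift by one turns the inner sum into \<open>odd_harm2 k\<close>, and the central
  binomial coefficient at k+1 is 2(2k+1) times the k-th Catalan number.\<close>

lemma arcsin3_coeff_Suc_eq:
  "2 * 4 ^ k * arcsin3_coeff (Suc k)
   = (2 * real k + 1) / (2 * real k + 3) * odd_harm2 k * catalan k"
proof -
  have O: "(\<Sum>j<Suc k. 1 / (2 * real j + 1)\<^sup>2) = odd_harm2 k"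
    by (simp only: odd_harm2_def atLeast0AtMost lessThan_Suc_atMost)
  have "real ((2 * Suc k) choose Suc k) = 2 * (2 * real k + 1) * catalan k"
    using central_binomial_Suc[of k] by (simp add: catalan_def field_simps del: binomial_Suc_Suc)
  then show ?thesis
    unfolding arcsin3_coeff_def O arcsin_coeff_def
    by (simp add: divide_simps del: binomial_Suc_Suc) (simp add: algebra_simps)
qed

definition odd_harm_catalan :: "nat \<Rightarrow> complex" where
  "odd_harm_catalan k = of_nat (2 * k + 1) / of_nat (2 * k + 3)
     * complex_of_real (odd_harm2 k) * complex_of_real (catalan k)"

lemma odd_harm_catalan_sums:
  assumes "norm t \<le> 1" "t \<noteq> 0"
  shows "(\<lambda>k. odd_harm_catalan k * (t\<^sup>2 / 4) ^ k) sums (Arcsin t ^ 3 / (3 * t ^ 3))"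
proof -
  \<comment> \<open>The term of index 0 vanishes, so the series starts at t^3 and can be divided by
    t^3.\<close>
  have "(\<lambda>k. complex_of_real (arcsin3_coeff (Suc k)) * t ^ (2 * Suc k + 1)) sums (Arcsin t ^ 3 / 6)"
    using Arcsin_cubed_series[OF assms(1)]
    by (subst sums_Suc_iff) (simp add: arcsin3_coeff_def)
  then have "(\<lambda>k. 2 / t ^ 3 * (complex_of_real (arcsin3_coeff (Suc k)) * t ^ (2 * Suc k + 1)))
      sums (2 / t ^ 3 * (Arcsin t ^ 3 / 6))"
    by (rule sums_mult)
  moreover have "2 / t ^ 3 * (complex_of_real (arcsin3_coeff (Suc k)) * t ^ (2 * Suc k + 1))
      = odd_harm_catalan k * (t\<^sup>2 / 4) ^ k" for k
  proof -
    have "odd_harm_catalan k = complex_of_real (2 * 4 ^ k * arcsin3_coeff (Suc k))"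
      unfolding arcsin3_coeff_Suc_eq by (simp add: odd_harm_catalan_def)
    moreover have "t ^ (2 * Suc k + 1) = t ^ 3 * (t\<^sup>2) ^ k"
      by (simp add: power_mult[symmetric] power3_eq_cube)
    ultimately show ?thesis
      using assms(2) by (simp add: power_divide del: power_Suc)
  qed
  ultimately show ?thesis
    by simp
qed

text \<open>Half sum and half difference isolate the even and the odd indices, and the even powers
  of \<i> become the signs. In the odd part the remaining factor \<open>\<i> * x\<close> is divided
  out.\<close>

lemma even_odd_part_sums:
  fixes a :: "nat \<Rightarrow> complex"
  assumes "(\<lambda>k. a k * (\<i> * x) ^ k) sums S" "(\<lambda>k. a k * (- \<i> * x) ^ k) sums T"
  shows "(\<lambda>n. (- 1) ^ n * a (2 * n) * x ^ (2 * n)) sums ((S + T) / 2)"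
    and "x \<noteq> 0 \<Longrightarrow> (\<lambda>n. (- 1) ^ n * a (2 * n + 1) * x ^ (2 * n)) sums ((S - T) / (2 * \<i> * x))"
proof -
  have neg: "(- \<i> * x) ^ k = (- 1) ^ k * (\<i> * x) ^ k" for k
    by (simp add: power_mult_distrib[symmetric])
  have sq: "(\<i> * x) ^ (2 * n) = (- 1) ^ n * x ^ (2 * n)" for n
    by (simp add: power_mult power_mult_distrib power_minus[of "x\<^sup>2"])
  define f where "f k = (a k * (\<i> * x) ^ k + a k * (- \<i> * x) ^ k) / 2" for k
  have "f sums ((S + T) / 2)"
    unfolding f_def by (intro sums_divide sums_add assms)
  moreover have "f n = 0" if "n \<notin> range (\<lambda>n. 2 * n)" for n
    using that unfolding f_def neg by (cases "even n") (auto elim!: evenE)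
  ultimately have "(\<lambda>n. f (2 * n)) sums ((S + T) / 2)"
    by (subst sums_mono_reindex) (auto simp: strict_mono_def)
  moreover have "f (2 * n) = (- 1) ^ n * a (2 * n) * x ^ (2 * n)" for n
    unfolding f_def neg sq by (simp add: mult_ac)
  ultimately show "(\<lambda>n. (- 1) ^ n * a (2 * n) * x ^ (2 * n)) sums ((S + T) / 2)"
    by simp
  assume "x \<noteq> 0"
  define g where "g k = (a k * (\<i> * x) ^ k - a k * (- \<i> * x) ^ k) / (2 * \<i> * x)" for k
  have "g sums ((S - T) / (2 * \<i> * x))"
    unfolding g_def by (intro sums_divide sums_diff assms)
  moreover have "g n = 0" if "n \<notin> range (\<lambda>n. 2 * n + 1)" for n
    using that unfolding g_def neg by (cases "even n") (auto elim!: oddE)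
  ultimately have "(\<lambda>n. g (2 * n + 1)) sums ((S - T) / (2 * \<i> * x))"
    by (subst sums_mono_reindex) (auto simp: strict_mono_def)
  moreover have "g (2 * n + 1) = (- 1) ^ n * a (2 * n + 1) * x ^ (2 * n)" for n
    unfolding g_def neg power_add sq using \<open>x \<noteq> 0\<close> by (simp add: field_simps)
  ultimately show "(\<lambda>n. (- 1) ^ n * a (2 * n + 1) * x ^ (2 * n)) sums ((S - T) / (2 * \<i> * x))"
    by simp
qed

theorem theorem14:
  fixes x z :: complex
  assumes "0 < cmod x" and "cmod x \<le> 1 / 4"
    and "z = (csqrt (1 + 16 * x ^ 2) - 1) / (4 * x)"
  shows "((\<lambda>n. (- 1) ^ (n + 1) * (of_nat (4 * n + 1) / of_nat (4 * n + 3))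
             * complex_of_real (odd_harm2 (2 * n)) * complex_of_real (catalan (2 * n))
             * x ^ (2 * n))
         sums
         ((Arctan (csqrt z) + artanh (csqrt z)) / (24 * (csqrt 2 * csqrt x ^ 3))
          * ((Arctan (csqrt z))\<^sup>2 - 4 * Arctan (csqrt z) * artanh (csqrt z)
             + (artanh (csqrt z))\<^sup>2)))
       \<and> ((\<lambda>n. (- 1) ^ (n + 1) * (of_nat (4 * n + 3) / of_nat (4 * n + 5))
             * complex_of_real (odd_harm2 (2 * n + 1)) * complex_of_real (catalan (2 * n + 1))
             * x ^ (2 * n))
         sums
         ((Arctan (csqrt z) - artanh (csqrt z)) / (24 * (csqrt 2 * csqrt x ^ 5))
          * ((Arctan (csqrt z))\<^sup>2 + 4 * Arctan (csqrt z) * artanh (csqrt z)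
             + (artanh (csqrt z))\<^sup>2)))"
proof -
  define A B s d where "A = Arctan (csqrt z)" and "B = artanh (csqrt z)"
    and "s = csqrt x" and "d = csqrt 2"
  define V W where "V = A + \<i> * B" and "W = A - \<i> * B"
  define t t' where "t = (1 + \<i>) * d * s" and "t' = (1 - \<i>) * d * s"
  have "x \<noteq> 0"
    using assms(1) by auto
  have s2: "s\<^sup>2 = x" and d2: "d\<^sup>2 = 2"
    by (simp_all only: s_def d_def power2_csqrt)
  have nz: "s \<noteq> 0" "d \<noteq> 0"
    using s2 d2 \<open>x \<noteq> 0\<close> by auto
  have one_i: "(1 + \<i>)\<^sup>2 = 2 * \<i>" "(1 - \<i>)\<^sup>2 = - 2 * \<i>"
    by (simp_all add: power2_eq_square algebra_simps)
  have t2: "t\<^sup>2 / 4 = \<i> * x" "t'\<^sup>2 / 4 = - \<i> * x"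
    by (simp_all add: t_def t'_def power_mult_distrib s2 d2 one_i)
  have "1 + \<i> \<noteq> 0" "1 - \<i> \<noteq> 0"
    by (simp_all add: complex_eq_iff)
  then have tnz: "t \<noteq> 0" "t' \<noteq> 0"
    using nz by (simp_all add: t_def t'_def)
  have "norm (t\<^sup>2) \<le> 1\<^sup>2" "norm (t'\<^sup>2) \<le> 1\<^sup>2"
    using assms(2) arg_cong[OF t2(1), of norm] arg_cong[OF t2(2), of norm]
    by (simp_all add: norm_mult norm_divide)
  then have "norm t \<le> 1" "norm t' \<le> 1"
    unfolding norm_power by (simp_all only: power2_le_imp_le zero_le_one)
  from odd_harm_catalan_sums[OF this(1) tnz(1)] odd_harm_catalan_sums[OF this(2) tnz(2)]
  have "(\<lambda>k. odd_harm_catalan k * (\<i> * x) ^ k) sums (V ^ 3 / (3 * t ^ 3))"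
    "(\<lambda>k. odd_harm_catalan k * (- \<i> * x) ^ k) sums (W ^ 3 / (3 * t' ^ 3))"
    using Arctan_artanh_eq_Arcsin[OF \<open>x \<noteq> 0\<close> assms(2,3)]
    unfolding t2 by (simp_all only: V_def W_def A_def B_def t_def t'_def d_def s_def)
  note parts = even_odd_part_sums[OF this]
  define D where "D = d * s ^ 3"
  have "D \<noteq> 0"
    using nz by (simp add: D_def)
  \<comment> \<open>The extra factor completes \<open>(1 \<plusminus> \<i>) ^ 4 = - 4\<close>, so
    both cubes acquire the common denominator \<open>D\<close> up to a factor.\<close>
  have "t ^ 3 * (1 + \<i>) = ((1 + \<i>)\<^sup>2)\<^sup>2 * d\<^sup>2 * D" "t' ^ 3 * (1 - \<i>) = ((1 - \<i>)\<^sup>2)\<^sup>2 * d\<^sup>2 * D"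
    by (simp_all only: t_def t'_def D_def power2_eq_square power3_eq_cube mult_ac)
  then have t3: "t ^ 3 * (1 + \<i>) = - 8 * D" "t' ^ 3 * (1 - \<i>) = - 8 * D"
    unfolding one_i d2 by (simp_all add: power2_eq_square)
  have quot: "V ^ 3 / (3 * t ^ 3) = - (1 + \<i>) * V ^ 3 / (24 * D)"
    "W ^ 3 / (3 * t' ^ 3) = - (1 - \<i>) * W ^ 3 / (24 * D)"
    using tnz \<open>D \<noteq> 0\<close> t3 by (simp_all add: frac_eq_eq) (algebra)+
  have ii: "\<i> * \<i> = -1"
    by simp
  have cubes: "(1 + \<i>) * V ^ 3 + (1 - \<i>) * W ^ 3 = 2 * ((A + B) * (A\<^sup>2 - 4 * A * B + B\<^sup>2))"
    "(1 + \<i>) * V ^ 3 - (1 - \<i>) * W ^ 3 = 2 * \<i> * ((A - B) * (A\<^sup>2 + 4 * A * B + B\<^sup>2))"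
    unfolding V_def W_def using ii by algebra+
  show ?thesis
    unfolding A_def[symmetric] B_def[symmetric] s_def[symmetric] d_def[symmetric]
  proof
    \<comment> \<open>The leading minus accounts for the exponent n + 1 of -1, since the even and
      odd parts carry exponent n.\<close>
    have "- ((V ^ 3 / (3 * t ^ 3) + W ^ 3 / (3 * t' ^ 3)) / 2)
        = ((1 + \<i>) * V ^ 3 + (1 - \<i>) * W ^ 3) / (48 * D)"
      unfolding quot using \<open>D \<noteq> 0\<close> by (simp add: field_simps)
    also have "\<dots> = (A + B) / (24 * (d * s ^ 3)) * (A\<^sup>2 - 4 * A * B + B\<^sup>2)"
      unfolding cubes D_def by simp
    finally show "(\<lambda>n. (- 1) ^ (n + 1) * (of_nat (4 * n + 1) / of_nat (4 * n + 3))
        * complex_of_real (odd_harm2 (2 * n)) * complex_of_real (catalan (2 * n)) * x ^ (2 * n))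
      sums ((A + B) / (24 * (d * s ^ 3)) * (A\<^sup>2 - 4 * A * B + B\<^sup>2))"
      using sums_minus[OF parts(1)] by (simp add: odd_harm_catalan_def mult_ac)
    have "- ((V ^ 3 / (3 * t ^ 3) - W ^ 3 / (3 * t' ^ 3)) / (2 * \<i> * x))
        = ((1 + \<i>) * V ^ 3 - (1 - \<i>) * W ^ 3) / (48 * \<i> * (D * x))"
      unfolding quot using \<open>D \<noteq> 0\<close> \<open>x \<noteq> 0\<close> by (simp add: field_simps)
    \<comment> \<open>The factor \<open>x = s\<^sup>2\<close> left by the odd part raises the half
      power from 3 to 5.\<close>
    also have "D * x = d * s ^ 5"
      unfolding D_def s2[symmetric] by (simp flip: power_add)
    also have "((1 + \<i>) * V ^ 3 - (1 - \<i>) * W ^ 3) / (48 * \<i> * (d * s ^ 5))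
        = (A - B) / (24 * (d * s ^ 5)) * (A\<^sup>2 + 4 * A * B + B\<^sup>2)"
      unfolding cubes by simp
    finally show "(\<lambda>n. (- 1) ^ (n + 1) * (of_nat (4 * n + 3) / of_nat (4 * n + 5))
        * complex_of_real (odd_harm2 (2 * n + 1)) * complex_of_real (catalan (2 * n + 1)) * x ^ (2 * n))
      sums ((A - B) / (24 * (d * s ^ 5)) * (A\<^sup>2 + 4 * A * B + B\<^sup>2))"
      using sums_minus[OF parts(2)[OF \<open>x \<noteq> 0\<close>]] by (simp add: odd_harm_catalan_def mult_ac add_ac)
  qed
qed

end
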